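(* Let $\mathcal{G}$ be a geometric algebra, $a\in\mathcal{G}_1$ a vector and $A_r$ an invertible $r$-blade. Then the orthogonal projection $P_{A_r}(a)$ of $a$ into the subspace represented by $A_r$ and the orthogonal rejection $R_{A_r}(a)$ of $a$ from that subspace are given by $$P_{A_r}(a)=(a\rfloor A_r)\,A_r^{-1}=(a\rfloor A_r)\rfloor A_r^{-1},$$ $$R_{A_r}(a)=(a\wedge A_r)\,A_r^{-1}=(a\wedge A_r)\lfloor A_r^{-1}.$$
   Context: A geometric algebra $\mathcal{G}$ is a ring with unit containing a field $\mathcal{G}_0$ of characteristic zero (the scalars, with $0,1\in\mathcal{G}_0$) and a subset $\mathcal{G}_1$ (the vectors) closed under addition with $\lambda v=v\lambda\in\mathcal{G}_1$ for all $\lambda\in\mathcal{G}_0$, $v\in\mathcal{G}_1$ (so $\mathcal{G}_1$ is a $\mathcal{G}_0$-vector space), such that: the square of every vector is a scalar; the symmetric bilinear inner product of vectors $u\rfloor v=\frac12(uv+vu)\in\mathcal{G}_0$ is nondegenerate (the only vector orthogonal to all vectors is $0$); and $\mathcal{G}$ is the direct sum of the subspaces $\mathcal{G}_r$, $r\ge 0$, defined as follows. Vectors $u,v$ are orthogonal if $u\rfloor v=0$. For $r\ge 2$ an $r$-blade is a product of $r$ pairwise orthogonal vectors; $0$-blades are the scalars and $1$-blades the vectors. An $r$-vector is a finite sum of $r$-blades, and $\mathcal{G}_r$ is the set of $r$-vectors. $\langle A\rangle_r$ denotes the component of $A\in\mathcal{G}$ in $\mathcal{G}_r$, with $\langle A\rangle_r=0$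 for $r<0$. For $A=\sum_rA_r$ and $B=\sum_sB_s$ with $A_r\in\mathcal{G}_r$, $B_s\in\mathcal{G}_s$: $$A\rfloor B:=\sum_{r,s}\langle A_rB_s\rangle_{s-r},\quad A\lfloor B:=\sum_{r,s}\langle A_rB_s\rangle_{r-s},\quad A\wedge B:=\sum_{r,s}\langle A_rB_s\rangle_{r+s}.$$ A nonzero $r$-blade $A_r$ represents the $r$-dimensional subspace $\{a\in\mathcal{G}_1:a\wedge A_r=0\}$. A blade is invertible if it has a multiplicative inverse in $\mathcal{G}$; a nonzero blade is invertible iff the inner product is nondegenerate on the subspace $S$ it represents. In that case every vector $a$ can be written uniquely as $a=p+q$ with $p\in S$ and $q$ orthogonal to every vector of $S$; $p=P_{A_r}(a)$ is the orthogonal projection of $a$ into $S$ and $q=R_{A_r}(a)$ is the orthogonal rejection of $a$ from $S$. *)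

theory Defs
  imports Main
begin

text \<open>
  The geometric algebra is the whole ring type; its scalars \<open>G0\<close> and its vectors \<open>G1\<close> are
  subsets of that type and are explicit parameters of all notions that depend on them.
\<close>

text \<open>The inverse predicates of the library need a division ring or commutativity.\<close>

definition mult_inverses :: "'a::ring_1 \<Rightarrow> 'a \<Rightarrow> bool" where
  "mult_inverses x y \<longleftrightarrow> x * y = 1 \<and> y * x = 1"

definition invertible_elt :: "'a::ring_1 \<Rightarrow> bool" where
  "invertible_elt x \<longleftrightarrow> (\<exists>y. mult_inverses x y)"

definition mult_inv :: "'a::ring_1 \<Rightarrow> 'a" where
  "mult_inv x = (THE y. mult_inverses x y)"

text \<open>Meaningful for vectors only; \<open>mult_inv 2\<close> is the scalar one half.\<close>

definition inner_prod :: "'a::ring_1 \<Rightarrow> 'a \<Rightarrow> 'a" where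
  "inner_prod u v = mult_inv 2 * (u * v + v * u)"

definition orthogonal_vecs :: "'a::ring_1 \<Rightarrow> 'a \<Rightarrow> bool" where
  "orthogonal_vecs u v \<longleftrightarrow> inner_prod u v = 0"

definition is_blade :: "'a::ring_1 set \<Rightarrow> 'a set \<Rightarrow> nat \<Rightarrow> 'a \<Rightarrow> bool" where
  "is_blade G0 G1 r A \<longleftrightarrow>
     (if r = 0 then A \<in> G0
      else if r = 1 then A \<in> G1
      else (\<exists>vs. length vs = r \<and> set vs \<subseteq> G1 \<and>
              (\<forall>i<r. \<forall>j<r. i \<noteq> j \<longrightarrow> orthogonal_vecs (vs ! i) (vs ! j)) \<and>
              A = prod_list vs))"

definition multivecs :: "'a::ring_1 set \<Rightarrow> 'a set \<Rightarrow> nat \<Rightarrow> 'a set" where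
  "multivecs G0 G1 r = {sum_list bs | bs. \<forall>b\<in>set bs. is_blade G0 G1 r b}"

definition grade_decomp :: "'a::ring_1 set \<Rightarrow> 'a set \<Rightarrow> 'a \<Rightarrow> (nat \<Rightarrow> 'a) \<Rightarrow> bool" where
  "grade_decomp G0 G1 A f \<longleftrightarrow>
     (\<forall>r. f r \<in> multivecs G0 G1 r) \<and> finite {r. f r \<noteq> 0} \<and> A = (\<Sum>r | f r \<noteq> 0. f r)"

locale geometric_algebra =
  fixes G0 G1 :: "'a::ring_1 set"
  assumes scalar_zero: "0 \<in> G0"
    and scalar_one: "1 \<in> G0"
    and scalar_add: "\<lbrakk>x \<in> G0; y \<in> G0\<rbrakk> \<Longrightarrow> x + y \<in> G0"
    and scalar_uminus: "x \<in> G0 \<Longrightarrow> - x \<in> G0"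
    and scalar_mult: "\<lbrakk>x \<in> G0; y \<in> G0\<rbrakk> \<Longrightarrow> x * y \<in> G0"
    and scalar_commute: "\<lbrakk>x \<in> G0; y \<in> G0\<rbrakk> \<Longrightarrow> x * y = y * x"
    and scalar_inverse: "\<lbrakk>x \<in> G0; x \<noteq> 0\<rbrakk> \<Longrightarrow> \<exists>y\<in>G0. mult_inverses x y"
    and char_zero: "n > 0 \<Longrightarrow> (of_nat n :: 'a) \<noteq> 0"
    and vec_zero: "0 \<in> G1"
    and vec_add: "\<lbrakk>u \<in> G1; v \<in> G1\<rbrakk> \<Longrightarrow> u + v \<in> G1"
    and scalar_vec_commute: "\<lbrakk>x \<in> G0; v \<in> G1\<rbrakk> \<Longrightarrow> x * v = v * x"
    and scalar_vec_closed: "\<lbrakk>x \<in> G0; v \<in> G1\<rbrakk> \<Longrightarrow> x * v \<in> G1"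
    and vec_square: "v \<in> G1 \<Longrightarrow> v * v \<in> G0"
    and nondegenerate: "\<lbrakk>u \<in> G1; \<forall>v\<in>G1. orthogonal_vecs u v\<rbrakk> \<Longrightarrow> u = 0"
    and direct_sum: "\<exists>!f. grade_decomp G0 G1 A f"

text \<open>Grades of components are integers, so that a negative grade yields \<open>0\<close>.\<close>

definition grade_part :: "'a::ring_1 set \<Rightarrow> 'a set \<Rightarrow> int \<Rightarrow> 'a \<Rightarrow> 'a" where
  "grade_part G0 G1 k A = (if k < 0 then 0 else (THE f. grade_decomp G0 G1 A f) (nat k))"

definition grades :: "'a::ring_1 set \<Rightarrow> 'a set \<Rightarrow> 'a \<Rightarrow> int set" where
  "grades G0 G1 A = {k. grade_part G0 G1 k A \<noteq> 0}"

definition graded_prod ::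
  "(int \<Rightarrow> int \<Rightarrow> int) \<Rightarrow> 'a::ring_1 set \<Rightarrow> 'a set \<Rightarrow> 'a \<Rightarrow> 'a \<Rightarrow> 'a" where
  "graded_prod d G0 G1 A B =
     (\<Sum>r\<in>grades G0 G1 A. \<Sum>s\<in>grades G0 G1 B.
        grade_part G0 G1 (d r s) (grade_part G0 G1 r A * grade_part G0 G1 s B))"

definition left_contr :: "'a::ring_1 set \<Rightarrow> 'a set \<Rightarrow> 'a \<Rightarrow> 'a \<Rightarrow> 'a" where
  "left_contr = graded_prod (\<lambda>r s. s - r)"

definition right_contr :: "'a::ring_1 set \<Rightarrow> 'a set \<Rightarrow> 'a \<Rightarrow> 'a \<Rightarrow> 'a" where
  "right_contr = graded_prod (\<lambda>r s. r - s)"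

definition outer_prod :: "'a::ring_1 set \<Rightarrow> 'a set \<Rightarrow> 'a \<Rightarrow> 'a \<Rightarrow> 'a" where
  "outer_prod = graded_prod (\<lambda>r s. r + s)"

definition blade_space :: "'a::ring_1 set \<Rightarrow> 'a set \<Rightarrow> 'a \<Rightarrow> 'a set" where
  "blade_space G0 G1 A = {a \<in> G1. outer_prod G0 G1 a A = 0}"

definition orth_decomp :: "'a::ring_1 set \<Rightarrow> 'a set \<Rightarrow> 'a \<Rightarrow> 'a \<Rightarrow> 'a \<Rightarrow> 'a \<Rightarrow> bool" where
  "orth_decomp G0 G1 A a p q \<longleftrightarrow>
     p \<in> blade_space G0 G1 A \<and>
     q \<in> G1 \<and> (\<forall>s\<in>blade_space G0 G1 A. orthogonal_vecs q s) \<and>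
     a = p + q"

definition projection :: "'a::ring_1 set \<Rightarrow> 'a set \<Rightarrow> 'a \<Rightarrow> 'a \<Rightarrow> 'a" where
  "projection G0 G1 A a = (THE p. \<exists>q. orth_decomp G0 G1 A a p q)"

definition rejection :: "'a::ring_1 set \<Rightarrow> 'a set \<Rightarrow> 'a \<Rightarrow> 'a \<Rightarrow> 'a" where
  "rejection G0 G1 A a = (THE q. \<exists>p. orth_decomp G0 G1 A a p q)"

end

theory Submission
  imports Defs
begin

text \<open>
  Write \<open>A = c v\<^sub>1 \<cdots> v\<^sub>r\<close> with pairwise orthogonal vectors \<open>v\<^sub>i\<close>. Since \<open>A\<close> is invertible, no
  \<open>v\<^sub>i\<close> squares to zero, so \<open>a = p + q\<close> where \<open>p\<close> is the sum of the \<open>(a \<rfloor> v\<^sub>i) v\<^sub>i\<^sup>-\<^sup>1\<close> and \<open>q\<close> is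
  orthogonal to all \<open>v\<^sub>i\<close>. In \<open>a A = p A + q A\<close> the first summand has grade \<open>r - 1\<close>, because
  \<open>v\<^sub>i\<close> cancels against the same factor of \<open>A\<close>, and the second has grade \<open>r + 1\<close>. Hence
  \<open>a \<rfloor> A = p A\<close> and \<open>a \<and> A = q A\<close>, and multiplication by \<open>A\<^sup>-\<^sup>1\<close> gives \<open>p\<close> and \<open>q\<close>. As \<open>A\<^sup>-\<^sup>1\<close> is
  a scalar multiple of \<open>A\<close>, it has grade \<open>r\<close>, so the products \<open>(p A) A\<^sup>-\<^sup>1\<close> and \<open>(q A) A\<^sup>-\<^sup>1\<close>, which
  are vectors, agree with the contractions.
\<close>

section \<open>Two-sided inverses in a noncommutative ring\<close>

lemma mult_inverses_unique:
  assumes "mult_inverses x y" "mult_inverses x z"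
  shows "y = z"
  using assms unfolding mult_inverses_def by (metis mult.assoc mult_1_left mult_1_right)

lemma mult_inv_eq: "mult_inverses x y \<Longrightarrow> mult_inv x = y"
  unfolding mult_inv_def by (rule the_equality) (auto intro: mult_inverses_unique)

lemma mult_inverses_mult_inv: "invertible_elt x \<Longrightarrow> mult_inverses x (mult_inv x)"
  unfolding invertible_elt_def using mult_inv_eq by blast

lemma mult_mult_inv_right: "invertible_elt A \<Longrightarrow> x * A * mult_inv A = x"
  using mult_inverses_mult_inv[of A] by (simp add: mult_inverses_def mult.assoc)

lemma invertible_elt_cancel_right: "invertible_elt A \<Longrightarrow> x * A = 0 \<Longrightarrow> x = 0"
  using mult_mult_inv_right[of A x] by simp

context geometric_algebra
begin

subsection \<open>Scalars and the inner product\<close>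

lemma scalar_mult_inv:
  assumes "x \<in> G0" "x \<noteq> 0"
  shows "mult_inv x \<in> G0" "x * mult_inv x = 1" "mult_inv x * x = 1"
  using scalar_inverse[OF assms] mult_inv_eq by (auto simp: mult_inverses_def)

lemma scalar_diff: "x \<in> G0 \<Longrightarrow> y \<in> G0 \<Longrightarrow> x - y \<in> G0"
  using scalar_add[of x "- y"] scalar_uminus[of y] by simp

lemma vec_uminus: "v \<in> G1 \<Longrightarrow> - v \<in> G1"
  using scalar_vec_closed[of "- 1" v] scalar_uminus[OF scalar_one] by simp

lemma vec_diff: "u \<in> G1 \<Longrightarrow> v \<in> G1 \<Longrightarrow> u - v \<in> G1"
  using vec_add[of u "- v"] vec_uminus[of v] by simp

lemma half_scalar: "mult_inv 2 \<in> G0" and half_double: "mult_inv 2 * (x + x) = x"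
  for x :: 'a
proof -
  have two: "(2::'a) \<in> G0" "(2::'a) \<noteq> 0"
    using scalar_add[OF scalar_one scalar_one] char_zero[of 2] by simp_all
  show "mult_inv 2 \<in> G0" by (rule scalar_mult_inv(1)[OF two])
  have "mult_inv 2 * (x + x) = (mult_inv 2 * 2) * x"
    by (simp only: mult_2[symmetric] mult.assoc)
  then show "mult_inv 2 * (x + x) = x" by (simp add: scalar_mult_inv(3)[OF two])
qed

lemma orthogonal_vecs_iff: "orthogonal_vecs u v \<longleftrightarrow> u * v = - (v * u)"
  for u v :: 'a
proof -
  have "mult_inv 2 * x = 0 \<longleftrightarrow> x = 0" for x :: 'a
  proof
    assume "mult_inv 2 * x = 0"
    then have "mult_inv 2 * (x + x) = 0" by (simp add: distrib_left)
    then show "x = 0" by (simp only: half_double)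
  qed simp
  then show ?thesis by (simp add: orthogonal_vecs_def inner_prod_def eq_neg_iff_add_eq_0)
qed

lemma orthogonal_vecs_sym: "orthogonal_vecs u v \<Longrightarrow> orthogonal_vecs v u"
  by (simp add: orthogonal_vecs_def inner_prod_def add.commute)

text \<open>Polarization: \<open>u * v + v * u\<close> is a combination of squares of
  vectors.\<close>

lemma inner_prod_scalar:
  assumes "u \<in> G1" "v \<in> G1"
  shows "inner_prod u v \<in> G0"
proof -
  have "u * v + v * u = (u + v) * (u + v) - u * u - v * v"
    by (simp add: algebra_simps)
  then have "u * v + v * u \<in> G0"
    using assms by (simp only: scalar_diff vec_square vec_add)
  then show ?thesis by (simp add: inner_prod_def scalar_mult half_scalar)
qed

lemma inner_prod_add_left: "inner_prod (u + v) w = inner_prod u w + inner_prod v w"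
  by (simp add: inner_prod_def algebra_simps)

lemma inner_prod_diff_left: "inner_prod (u - v) w = inner_prod u w - inner_prod v w"
  by (simp add: inner_prod_def algebra_simps)

lemma inner_prod_scale_left:
  assumes "c \<in> G0" "v \<in> G1" "w \<in> G1"
  shows "inner_prod (c * v) w = c * inner_prod v w"
proof -
  have "c * v * w + w * (c * v) = c * (v * w + w * v)"
    using scalar_vec_commute[OF assms(1,3)] by (simp add: distrib_left flip: mult.assoc)
  then show ?thesis
    using scalar_commute[OF half_scalar assms(1)] by (simp add: inner_prod_def flip: mult.assoc)
qed

lemma inner_prod_self: "inner_prod v v = v * v"
  for v :: 'a
  by (simp add: inner_prod_def half_double)

text \<open>The axioms make scalars commute with scalars and vectors only; products of vectors
  inherit this factor by factor.\<close>

lemma scalar_prod_list_commute: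
  assumes "c \<in> G0" "set vs \<subseteq> G1"
  shows "c * prod_list vs = prod_list vs * c"
  using assms(2)
proof (induction vs)
  case (Cons v vs)
  then have "c * v = v * c" "c * prod_list vs = prod_list vs * c"
    using scalar_vec_commute[OF assms(1)] by auto
  then show ?case by simp (metis mult.assoc)
qed simp

subsection \<open>Blades\<close>

text \<open>Orthogonality is symmetric, so comparing earlier with later entries suffices. The
  recursive form suits induction and splitting of lists.\<close>

lemma sorted_wrt_orthogonal_iff:
  "sorted_wrt orthogonal_vecs vs \<longleftrightarrow>
    (\<forall>i<length vs. \<forall>j<length vs. i \<noteq> j \<longrightarrow> orthogonal_vecs (vs ! i) (vs ! j))"
  unfolding sorted_wrt_iff_nth_less neq_iff by (auto intro: orthogonal_vecs_sym)

text \<open>A normal form that treats all grades alike: in grade 0 the coefficient is the blade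
  itself, otherwise it can be absorbed into the first vector.\<close>

lemma is_blade_iff:
  "is_blade G0 G1 r A \<longleftrightarrow>
    (\<exists>c vs. c \<in> G0 \<and> set vs \<subseteq> G1 \<and> sorted_wrt orthogonal_vecs vs \<and> length vs = r \<and>
            A = c * prod_list vs)"
  (is "_ \<longleftrightarrow> ?R")
proof
  assume "is_blade G0 G1 r A"
  then consider "r = 0" "A \<in> G0" | "r = 1" "A \<in> G1"
    | vs where "length vs = r" "set vs \<subseteq> G1" "sorted_wrt orthogonal_vecs vs" "A = prod_list vs"
    by (auto simp: is_blade_def sorted_wrt_orthogonal_iff split: if_splits)
  then show ?R
  proof cases
    case 1
    then show ?thesis by (intro exI[of _ A] exI[of _ "[]"]) auto
  next
    case 2
    then show ?thesis by (intro exI[of _ 1] exI[of _ "[A]"]) (auto simp: scalar_one)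
  next
    case (3 vs)
    then show ?thesis by (intro exI[of _ 1] exI[of _ vs]) (auto simp: scalar_one)
  qed
next
  assume ?R
  then obtain c vs where c: "c \<in> G0" and vs: "set vs \<subseteq> G1" "sorted_wrt orthogonal_vecs vs"
    "length vs = r" and A: "A = c * prod_list vs" by blast
  show "is_blade G0 G1 r A"
  proof (cases vs)
    case Nil
    then show ?thesis using c vs A by (simp add: is_blade_def)
  next
    case (Cons v ws)
    have "orthogonal_vecs (c * v) w" if "w \<in> set ws" for w
      using that vs Cons c inner_prod_scale_left[of c v w] by (auto simp: orthogonal_vecs_def)
    then have "sorted_wrt orthogonal_vecs (c * v # ws)" using vs Cons by simp
    moreover have "set (c * v # ws) \<subseteq> G1" using vs Cons c scalar_vec_closed by auto
    moreover have "A = prod_list (c * v # ws)" using A Cons by (simp add: mult.assoc)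
    ultimately have "\<exists>us. length us = r \<and> set us \<subseteq> G1 \<and> sorted_wrt orthogonal_vecs us
        \<and> A = prod_list us"
      using vs Cons by (intro exI[of _ "c * v # ws"]) auto
    moreover have "r = 1 \<Longrightarrow> A \<in> G1"
      using vs Cons A c scalar_vec_closed by auto
    ultimately show ?thesis
      using vs Cons unfolding is_blade_def sorted_wrt_orthogonal_iff by auto
  qed
qed

lemma blade_scale:
  assumes "c \<in> G0" "is_blade G0 G1 r A"
  shows "is_blade G0 G1 r (c * A)"
proof -
  from assms(2) obtain d vs where "d \<in> G0" "set vs \<subseteq> G1" "sorted_wrt orthogonal_vecs vs"
    "length vs = r" "A = d * prod_list vs" unfolding is_blade_iff by blast
  then show ?thesis
    unfolding is_blade_iff using scalar_mult[OF assms(1)]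
    by (intro exI[of _ "c * d"] exI[of _ vs]) (auto simp: mult.assoc)
qed

lemma anticommute_prod_list:
  fixes v :: 'a
  shows
  "\<forall>w\<in>set vs. orthogonal_vecs v w \<Longrightarrow> v * prod_list vs = (- 1) ^ length vs * prod_list vs * v"
proof (induction vs)
  case (Cons w vs)
  then have "v * w = - (w * v)" by (simp add: orthogonal_vecs_iff)
  then have "v * prod_list (w # vs) = - (w * (v * prod_list vs))"
    by (simp flip: mult.assoc)
  also have "\<dots> = - (w * (- 1) ^ length vs * prod_list vs * v)"
    using Cons by (simp add: mult.assoc)
  also have "w * (- 1) ^ length vs = (- 1) ^ length vs * w"
    by (cases "even (length vs)") simp_all
  finally show ?case by (simp add: mult.assoc)
qed simp

lemma minus_one_power_scalar: "(- 1) ^ n \<in> G0"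
  by (cases "even n") (simp_all add: scalar_one scalar_uminus)

text \<open>Anticommuting \<open>v\<close> past the factors before its own occurrence costs a sign
  \<open>e\<close> and produces the scalar \<open>v * v\<close>. This square stays visible because
  its vanishing matters for invertibility.\<close>

lemma factor_mult_prod_list:
  assumes "set vs \<subseteq> G1" "sorted_wrt orthogonal_vecs vs" "v \<in> set vs"
  obtains e us where "e \<in> G0" "set us \<subseteq> G1" "sorted_wrt orthogonal_vecs us"
    "length us = length vs - 1" "v * prod_list vs = e * (v * v) * prod_list us"
proof -
  obtain ys zs where vs: "vs = ys @ v # zs" using assms(3) by (meson split_list)
  have v: "v \<in> G1" using assms by auto
  have "\<forall>w\<in>set ys. orthogonal_vecs v w"
    using assms(2) orthogonal_vecs_sym by (auto simp: vs sorted_wrt_append)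
  then have "v * prod_list ys = (- 1) ^ length ys * prod_list ys * v"
    by (rule anticommute_prod_list)
  then have "v * prod_list vs = (- 1) ^ length ys * (prod_list ys * (v * v)) * prod_list zs"
    by (simp add: vs flip: mult.assoc)
  also have "prod_list ys * (v * v) = (v * v) * prod_list ys"
    using scalar_prod_list_commute[OF vec_square[OF v]] assms(1) by (simp add: vs)
  finally have "v * prod_list vs = (- 1) ^ length ys * (v * v) * prod_list (ys @ zs)"
    by (simp add: mult.assoc)
  then show ?thesis
    using that[OF minus_one_power_scalar, of "ys @ zs"] assms by (auto simp: vs sorted_wrt_append)
qed

lemma factor_mult_blade:
  assumes c: "c \<in> G0" and vs: "set vs \<subseteq> G1" "sorted_wrt orthogonal_vecs vs" and v: "v \<in> set vs"
  shows "is_blade G0 G1 (length vs - 1) (v * (c * prod_list vs))"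
proof -
  have v1: "v \<in> G1" using v vs by auto
  obtain e us where e: "e \<in> G0" and us: "set us \<subseteq> G1" "sorted_wrt orthogonal_vecs us"
    "length us = length vs - 1" and eq: "v * prod_list vs = e * (v * v) * prod_list us"
    using factor_mult_prod_list[OF vs v] by blast
  have "v * (c * prod_list vs) = c * (v * prod_list vs)"
    using scalar_vec_commute[OF c v1] by (simp flip: mult.assoc)
  also have "\<dots> = (c * (e * (v * v))) * prod_list us" by (simp only: eq mult.assoc)
  finally show ?thesis
    unfolding is_blade_iff using us c e vec_square[OF v1]
    by (intro exI[of _ "c * (e * (v * v))"] exI[of _ us]) (simp add: scalar_mult)
qed

text \<open>Anticommutation brings the two copies of the leading vector together:
  \<open>(v * P) * (v * P)\<close> is \<open>(v * v) * (P * P)\<close> up to sign.\<close>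

lemma prod_list_square_scalar:
  "set vs \<subseteq> G1 \<Longrightarrow> sorted_wrt orthogonal_vecs vs \<Longrightarrow> prod_list vs * prod_list vs \<in> G0"
proof (induction vs)
  case Nil
  then show ?case by (simp add: scalar_one)
next
  case (Cons v vs)
  let ?e = "(- 1) ^ length vs :: 'a" and ?P = "prod_list vs"
  have vv: "v * v \<in> G0" using Cons vec_square by simp
  have "v * ?P = ?e * ?P * v" using Cons by (intro anticommute_prod_list) simp
  then have "(v * ?P) * (v * ?P) = ?e * (?P * (v * v)) * ?P" by (simp only: mult.assoc)
  also have "?P * (v * v) = (v * v) * ?P"
    using scalar_prod_list_commute[OF vv, of vs] Cons by simp
  finally have "(v * ?P) * (v * ?P) = ?e * ((v * v) * (?P * ?P))" by (simp only: mult.assoc)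
  then show ?case
    using Cons vv by (simp add: scalar_mult minus_one_power_scalar)
qed

lemma blade_square_scalar:
  assumes "is_blade G0 G1 r A"
  shows "A * A \<in> G0"
proof -
  from assms obtain c vs where c: "c \<in> G0" and vs: "set vs \<subseteq> G1" "sorted_wrt orthogonal_vecs vs"
    and A: "A = c * prod_list vs" unfolding is_blade_iff by blast
  have "A * A = c * (prod_list vs * c) * prod_list vs" by (simp add: A mult.assoc)
  also have "\<dots> = c * c * (prod_list vs * prod_list vs)"
    by (simp add: mult.assoc flip: scalar_prod_list_commute[OF c vs(1)])
  finally show ?thesis by (simp add: c vs scalar_mult prod_list_square_scalar)
qed

lemma blade_mult_inv:
  assumes "is_blade G0 G1 r A" "invertible_elt A"
  shows "is_blade G0 G1 r (mult_inv A)"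
proof -
  let ?t = "A * A"
  have t: "?t \<in> G0" by (rule blade_square_scalar[OF assms(1)])
  have inv: "A * mult_inv A = 1" "mult_inv A * A = 1"
    using mult_inverses_mult_inv[OF assms(2)] by (auto simp: mult_inverses_def)
  \<comment> \<open>If \<open>A * A = 0\<close>, cancelling \<open>A\<close> gives
    \<open>A = 0\<close>, hence \<open>1 = 0\<close>, against characteristic zero.\<close>
  have "?t \<noteq> 0"
    using invertible_elt_cancel_right[OF assms(2), of A] inv char_zero[of 1] by force
  note t_inv = scalar_mult_inv[OF t this]
  have "mult_inv A = mult_inv ?t * ?t * mult_inv A" by (simp add: t_inv)
  also have "\<dots> = mult_inv ?t * A" by (simp add: mult.assoc inv)
  finally show ?thesis using blade_scale[OF t_inv(1) assms(1)] by simp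
qed

subsection \<open>Grades\<close>

lemma blade_multivecs: "is_blade G0 G1 r A \<Longrightarrow> A \<in> multivecs G0 G1 r"
  unfolding multivecs_def by (intro CollectI exI[of _ "[A]"]) simp

lemma zero_multivecs: "0 \<in> multivecs G0 G1 r"
  unfolding multivecs_def by (intro CollectI exI[of _ "[]"]) simp

lemma add_multivecs:
  assumes "x \<in> multivecs G0 G1 r" "y \<in> multivecs G0 G1 r"
  shows "x + y \<in> multivecs G0 G1 r"
proof -
  obtain bs cs where "x = sum_list bs" "\<forall>b\<in>set bs. is_blade G0 G1 r b"
    "y = sum_list cs" "\<forall>b\<in>set cs. is_blade G0 G1 r b"
    using assms unfolding multivecs_def by blast
  then show ?thesis unfolding multivecs_def by (intro CollectI exI[of _ "bs @ cs"]) auto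
qed

lemma vec_multivecs: "v \<in> G1 \<Longrightarrow> v \<in> multivecs G0 G1 1"
  by (simp add: blade_multivecs is_blade_def)

lemma grade_part_eq: "grade_decomp G0 G1 A f \<Longrightarrow> grade_part G0 G1 (int k) A = f k"
  using the1_equality[OF direct_sum, of A f] by (simp add: grade_part_def)

text \<open>By uniqueness of the grade decomposition it is enough to exhibit one.\<close>

lemma grade_part_add:
  assumes "x \<in> multivecs G0 G1 m" "y \<in> multivecs G0 G1 n" "m \<noteq> n"
  shows "grade_part G0 G1 (int k) (x + y) = (if k = m then x else if k = n then y else 0)"
proof (rule grade_part_eq)
  let ?f = "\<lambda>k. if k = m then x else if k = n then y else 0"
  have sub: "{k. ?f k \<noteq> 0} \<subseteq> {m, n}" by auto
  \<comment> \<open>The support can be smaller than \<open>{m, n}\<close>, as \<open>x\<close> or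
    \<open>y\<close> may be 0.\<close>
  have "sum ?f {k. ?f k \<noteq> 0} = sum ?f {m, n}"
    by (rule sum.mono_neutral_left[OF _ sub]) auto
  also have "\<dots> = x + y" using assms(3) by simp
  finally show "grade_decomp G0 G1 (x + y) ?f"
    unfolding grade_decomp_def using assms zero_multivecs finite_subset[OF sub] by auto
qed

lemma grade_part_multivec:
  assumes "x \<in> multivecs G0 G1 m"
  shows "grade_part G0 G1 k x = (if k = int m then x else 0)"
proof (cases "k < 0")
  case False
  then obtain n where "k = int n" by (metis nat_0_le not_le)
  \<comment> \<open>Zero lies in every grade; \<open>Suc m\<close> is chosen only to differ from
    \<open>m\<close>.\<close>
  then show ?thesis using grade_part_add[OF assms zero_multivecs[of "Suc m"], of n] by simp
qed (simp add: grade_part_def)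

lemma grade_part_zero: "grade_part G0 G1 k 0 = 0"
  using grade_part_multivec[OF zero_multivecs, of k 0] by simp

text \<open>Homogeneous factors collapse the double sum to one term. A zero factor has no grades at
  all, so that case is separate; both sides are then 0.\<close>

lemma graded_prod_multivecs:
  assumes A: "A \<in> multivecs G0 G1 m" and B: "B \<in> multivecs G0 G1 n"
  shows "graded_prod d G0 G1 A B = grade_part G0 G1 (d (int m) (int n)) (A * B)"
proof (cases "A = 0 \<or> B = 0")
  case True
  have "grades G0 G1 0 = {}" by (simp add: grades_def grade_part_zero)
  then show ?thesis using True by (auto simp: graded_prod_def grade_part_zero)
next
  case False
  then have "grades G0 G1 A = {int m}" "grades G0 G1 B = {int n}"
    by (auto simp: grades_def grade_part_multivec[OF A] grade_part_multivec[OF B])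
  then show ?thesis
    by (simp add: graded_prod_def grade_part_multivec[OF A] grade_part_multivec[OF B])
qed

subsection \<open>Projection onto the span of orthogonal vectors\<close>

text \<open>As \<open>mult_inv (v * v) * v\<close> is the inverse of a vector with nonzero square,
  this is the usual projection formula for an orthogonal list of such vectors.\<close>

definition span_proj :: "'a list \<Rightarrow> 'a \<Rightarrow> 'a" where
  "span_proj vs x = (\<Sum>v\<leftarrow>vs. inner_prod x v * mult_inv (v * v) * v)"

lemma span_proj_coeff_scalar:
  "x \<in> G1 \<Longrightarrow> v \<in> G1 \<Longrightarrow> v * v \<noteq> 0 \<Longrightarrow> inner_prod x v * mult_inv (v * v) \<in> G0"
  by (simp add: scalar_mult inner_prod_scalar scalar_mult_inv(1) vec_square)

lemma span_proj_vec:
  "x \<in> G1 \<Longrightarrow> set vs \<subseteq> G1 \<Longrightarrow> \<forall>v\<in>set vs. v * v \<noteq> 0 \<Longrightarrow> span_proj vs x \<in> G1"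
  by (induction vs)
    (auto simp: span_proj_def vec_zero intro!: vec_add scalar_vec_closed span_proj_coeff_scalar)

lemma span_proj_add: "span_proj vs (x + y) = span_proj vs x + span_proj vs y"
  by (simp add: span_proj_def inner_prod_add_left distrib_right flip: sum_list_addf)

lemma span_proj_orthogonal: "\<forall>v\<in>set vs. orthogonal_vecs x v \<Longrightarrow> span_proj vs x = 0"
  by (induction vs) (auto simp: span_proj_def orthogonal_vecs_def)

lemma inner_span_proj_orthogonal:
  assumes "x \<in> G1" "w \<in> G1" "set vs \<subseteq> G1" "\<forall>v\<in>set vs. v * v \<noteq> 0"
    "\<forall>v\<in>set vs. orthogonal_vecs v w"
  shows "inner_prod (span_proj vs x) w = 0"
  using assms(3-)
proof (induction vs)
  case Nil
  then show ?case by (simp add: span_proj_def inner_prod_def)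
next
  case (Cons v vs)
  then show ?case
    using inner_prod_scale_left[OF span_proj_coeff_scalar, of x v v w] assms(1,2)
    by (simp add: span_proj_def inner_prod_add_left orthogonal_vecs_def)
qed

text \<open>Only the summand of \<open>w\<close> survives, and there \<open>mult_inv (w * w)\<close>
  cancels \<open>w * w\<close>. Hence \<open>x - span_proj vs x\<close> is orthogonal to all of
  \<open>vs\<close>.\<close>

lemma inner_span_proj:
  assumes "x \<in> G1" "set vs \<subseteq> G1" "\<forall>v\<in>set vs. v * v \<noteq> 0" "sorted_wrt orthogonal_vecs vs"
    "w \<in> set vs"
  shows "inner_prod (span_proj vs x) w = inner_prod x w"
  using assms(2-)
proof (induction vs)
  case (Cons v vs)
  let ?c = "inner_prod x v * mult_inv (v * v)"
  have w: "w \<in> G1" and v: "v \<in> G1" "v * v \<noteq> 0" using Cons by auto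
  have head: "inner_prod (span_proj (v # vs) x) w
      = ?c * inner_prod v w + inner_prod (span_proj vs x) w"
    using inner_prod_scale_left[OF span_proj_coeff_scalar[OF assms(1) v] v(1) w]
    by (simp add: span_proj_def inner_prod_add_left)
  show ?case
  proof (cases "w \<in> set vs")
    case True
    then have "inner_prod v w = 0" using Cons by (simp add: orthogonal_vecs_def)
    then show ?thesis using head True Cons by simp
  next
    case False
    then have [simp]: "w = v" using Cons by simp
    have "inner_prod (span_proj vs x) w = 0"
      using Cons by (intro inner_span_proj_orthogonal assms(1)) (auto intro: orthogonal_vecs_sym)
    then show ?thesis
      using head v by (simp add: inner_prod_self mult.assoc scalar_mult_inv(3) vec_square)
  qed
qed simp

lemma span_proj_mult_multivecs:
  assumes x: "x \<in> G1" and c: "c \<in> G0" and vs: "set vs \<subseteq> G1" "\<forall>v\<in>set vs. v * v \<noteq> 0"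
    "sorted_wrt orthogonal_vecs vs"
  shows "span_proj vs x * (c * prod_list vs) \<in> multivecs G0 G1 (length vs - 1)"
proof -
  have single: "inner_prod x v * mult_inv (v * v) * v * (c * prod_list vs)
      \<in> multivecs G0 G1 (length vs - 1)" if v: "v \<in> set vs" for v
  proof -
    let ?k = "inner_prod x v * mult_inv (v * v)"
    have "?k \<in> G0" using v vs by (intro span_proj_coeff_scalar[OF x]) auto
    then have "is_blade G0 G1 (length vs - 1) (?k * (v * (c * prod_list vs)))"
      by (rule blade_scale) (rule factor_mult_blade[OF c vs(1,3) v])
    then show ?thesis by (intro blade_multivecs) (simp only: mult.assoc)
  qed
  \<comment> \<open>The list of summands is decoupled from \<open>vs\<close>, so that the induction
    shortens the sum and leaves the blade intact.\<close>
  have "(\<Sum>v\<leftarrow>ws. inner_prod x v * mult_inv (v * v) * v) * (c * prod_list vs)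
      \<in> multivecs G0 G1 (length vs - 1)" if "set ws \<subseteq> set vs" for ws
    using that
  proof (induction ws)
    case Nil
    then show ?case by (simp add: zero_multivecs)
  next
    case (Cons w ws)
    then show ?case using single[of w] by (simp add: distrib_right add_multivecs)
  qed
  then show ?thesis by (simp add: span_proj_def)
qed

subsection \<open>Invertible blades\<close>

text \<open>A factor with square 0 annihilates the blade, so cancelling the blade makes that factor
  0, and with it the blade.\<close>

lemma invertible_blade_factor_square:
  assumes c: "c \<in> G0" and vs: "set vs \<subseteq> G1" "sorted_wrt orthogonal_vecs vs"
    and inv: "invertible_elt (c * prod_list vs)" and v: "v \<in> set vs"
  shows "v * v \<noteq> 0"
proof
  assume zero: "v * v = 0"
  have v1: "v \<in> G1" using v vs by auto
  obtain e us where "v * prod_list vs = e * (v * v) * prod_list us"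
    using factor_mult_prod_list[OF vs v] by blast
  then have "c * (v * prod_list vs) = 0" using zero by simp
  then have "v * (c * prod_list vs) = 0"
    using scalar_vec_commute[OF c v1] by (simp flip: mult.assoc)
  then have "v = 0" by (rule invertible_elt_cancel_right[OF inv])
  then have "prod_list vs = 0" using v by (induction vs) auto
  then show False
    using mult_inverses_mult_inv[OF inv] char_zero[of 1] by (simp add: mult_inverses_def)
qed

end

section \<open>Projection and rejection for an invertible blade\<close>

theorem theorem31:
  fixes G0 G1 :: "'a::ring_1 set" and r :: nat and a A :: 'a
  assumes "geometric_algebra G0 G1"
    and "a \<in> G1"
    and "is_blade G0 G1 r A"
    and "invertible_elt A"
  shows "projection G0 G1 A a = left_contr G0 G1 a A * mult_inv A
       \<and> left_contr G0 G1 a A * mult_inv A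
           = left_contr G0 G1 (left_contr G0 G1 a A) (mult_inv A)
       \<and> rejection G0 G1 A a = outer_prod G0 G1 a A * mult_inv A
       \<and> outer_prod G0 G1 a A * mult_inv A
           = right_contr G0 G1 (outer_prod G0 G1 a A) (mult_inv A)"
proof -
  interpret geometric_algebra G0 G1 by (rule assms(1))
  note inv = assms(4)
  obtain c vs where c: "c \<in> G0" and vs: "set vs \<subseteq> G1" "sorted_wrt orthogonal_vecs vs"
    and len: "length vs = r" and A: "A = c * prod_list vs"
    using assms(3) unfolding is_blade_iff by blast
  have sq: "\<forall>v\<in>set vs. v * v \<noteq> 0"
    using invertible_blade_factor_square[OF c vs] inv by (simp add: A)
  let ?P = "span_proj vs" and ?Q = "\<lambda>x. x - span_proj vs x"
  have P_vec: "?P x \<in> G1" if "x \<in> G1" for x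
    using span_proj_vec[OF that vs(1) sq] .
  have Q_vec: "?Q x \<in> G1" if "x \<in> G1" for x
    using vec_diff[OF that P_vec[OF that]] .
  have Q_orth: "orthogonal_vecs (?Q x) v" if "x \<in> G1" "v \<in> set vs" for x v
    using inner_span_proj[OF that(1) vs(1) sq vs(2) that(2)]
    by (simp add: orthogonal_vecs_def inner_prod_diff_left)
  \<comment> \<open>For \<open>r = 0\<close> the truncated \<open>r - 1\<close> is 0; the claim
    survives since \<open>?P x = 0\<close>.\<close>
  have PA: "?P x * A \<in> multivecs G0 G1 (r - 1)" if "x \<in> G1" for x
    using span_proj_mult_multivecs[OF that c vs(1) sq vs(2)] by (simp add: A len)
  have QA: "?Q x * A \<in> multivecs G0 G1 (r + 1)" if x: "x \<in> G1" for x
  proof -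
    \<comment> \<open>\<open>?Q x\<close> is orthogonal to all of \<open>vs\<close>, so it extends
      the list to \<open>r + 1\<close> orthogonal factors.\<close>
    have "?Q x * A = c * prod_list (?Q x # vs)"
      using scalar_vec_commute[OF c Q_vec[OF x]] by (simp add: A flip: mult.assoc)
    then have "is_blade G0 G1 (r + 1) (?Q x * A)"
      unfolding is_blade_iff using c vs len Q_vec[OF x] Q_orth[OF x]
      by (intro exI[of _ c] exI[of _ "?Q x # vs"]) auto
    then show ?thesis by (rule blade_multivecs)
  qed
  have parts: "grade_part G0 G1 (int k) (x * A)
      = (if k = r - 1 then ?P x * A else if k = r + 1 then ?Q x * A else 0)"
    if x: "x \<in> G1" for x k
  proof -
    have "x * A = ?P x * A + ?Q x * A" by (simp add: left_diff_distrib)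
    then show ?thesis using grade_part_add[OF PA[OF x] QA[OF x], of k] by simp
  qed
  have A_r: "A \<in> multivecs G0 G1 r" by (rule blade_multivecs[OF assms(3)])
  have inv_r: "mult_inv A \<in> multivecs G0 G1 r"
    by (rule blade_multivecs[OF blade_mult_inv[OF assms(3) inv]])
  have scalar_case: "?P x = 0" if "r = 0" for x
    using that len by (simp add: span_proj_def)

  have left: "left_contr G0 G1 x A = ?P x * A" if x: "x \<in> G1" for x
  \<comment> \<open>For \<open>r = 0\<close> the contraction takes the part of integer grade -1,
    which is 0 by definition and agrees with \<open>?P x = 0\<close>.\<close>
  proof (cases "r = 0")
    case True
    then show ?thesis
      by (simp add: left_contr_def graded_prod_multivecs[OF vec_multivecs[OF x] A_r]
          scalar_case grade_part_zero grade_part_def)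
  next
    case False
    then have "int (r - 1) = int r - int 1" by simp
    then show ?thesis
      using parts[OF x, of "r - 1"]
      by (simp only: left_contr_def graded_prod_multivecs[OF vec_multivecs[OF x] A_r]) simp
  qed
  have "Suc r \<noteq> r - Suc 0" by arith
  then have outer: "outer_prod G0 G1 x A = ?Q x * A" if x: "x \<in> G1" for x
    using parts[OF x, of "r + 1"]
    by (simp add: outer_prod_def graded_prod_multivecs[OF vec_multivecs[OF x] A_r] add.commute)

  \<comment> \<open>The represented subspace is the fixed space of \<open>?P\<close>: the outer
    product with \<open>A\<close> is \<open>?Q x * A\<close>, and \<open>A\<close> can be
    cancelled.\<close>
  have space: "x \<in> blade_space G0 G1 A \<longleftrightarrow> x \<in> G1 \<and> ?P x = x" for x
  proof -
    have "?Q x * A = 0 \<longleftrightarrow> ?P x = x"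
      using invertible_elt_cancel_right[OF inv, of "?Q x"] by force
    then show ?thesis using outer[of x] by (auto simp: blade_space_def)
  qed
  have idem: "?P (?P x) = ?P x" if "x \<in> G1" for x
    using span_proj_add[of vs "?P x" "?Q x"] span_proj_orthogonal[of vs "?Q x"] Q_orth[OF that]
    by simp
  have factor_space: "v \<in> blade_space G0 G1 A" if v: "v \<in> set vs" for v
  proof -
    have v1: "v \<in> G1" using v vs by auto
    \<comment> \<open>All of \<open>v * A\<close> has grade \<open>r - 1\<close>, so nothing is left
      in grade \<open>r + 1\<close>.\<close>
    have "is_blade G0 G1 (r - 1) (v * A)"
      using factor_mult_blade[OF c vs v] by (simp add: A len)
    moreover have "int (r + 1) \<noteq> int (r - 1)" by arith
    ultimately have "grade_part G0 G1 (int (r + 1)) (v * A) = 0"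
      by (simp only: grade_part_multivec[OF blade_multivecs] if_False)
    then show ?thesis
      by (simp add: add.commute blade_space_def v1 outer_prod_def
          graded_prod_multivecs[OF vec_multivecs[OF v1] A_r])
  qed
  have orth: "orthogonal_vecs (?Q a) s" if "s \<in> blade_space G0 G1 A" for s
  proof -
    have s: "s \<in> G1" "?P s = s" using that space by auto
    have "inner_prod (?P s) (?Q a) = 0"
      using Q_orth[OF assms(2)] orthogonal_vecs_sym
      by (intro inner_span_proj_orthogonal s(1) Q_vec assms(2) vs(1) sq ballI) blast
    then have "orthogonal_vecs s (?Q a)" by (simp only: s(2) orthogonal_vecs_def)
    then show ?thesis by (rule orthogonal_vecs_sym)
  qed
  have decomp: "orth_decomp G0 G1 A a (?P a) (?Q a)"
    unfolding orth_decomp_def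
    using space idem[OF assms(2)] P_vec Q_vec orth assms(2) by simp
  have unique: "p = ?P a \<and> q = ?Q a" if "orth_decomp G0 G1 A a p q" for p q
  proof -
    \<comment> \<open>Applying \<open>?P\<close> to \<open>a = p + q\<close> recovers
      \<open>p\<close>: it fixes \<open>p\<close> and kills \<open>q\<close>, which is orthogonal to
      every \<open>v\<close> in \<open>vs\<close> by \<open>factor_space\<close>.\<close>
    have "?P p = p" "a = p + q" "?P q = 0"
      using that space factor_space span_proj_orthogonal[of vs q] by (auto simp: orth_decomp_def)
    then show ?thesis using span_proj_add[of vs p q] by simp
  qed
  have "projection G0 G1 A a = ?P a"
    unfolding projection_def using decomp unique by (intro the_equality) blast+
  moreover have "rejection G0 G1 A a = ?Q a"
    unfolding rejection_def using decomp unique by (intro the_equality) blast+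
  moreover have "left_contr G0 G1 (?P a * A) (mult_inv A) = ?P a"
  \<comment> \<open>With truncated subtraction the grade difference is 1 only for
    \<open>r > 0\<close>; for \<open>r = 0\<close> the left factor vanishes.\<close>
  proof (cases "r = 0")
    case True
    then show ?thesis
      by (simp add: scalar_case left_contr_def graded_prod_multivecs[OF zero_multivecs[of 0] inv_r]
          grade_part_zero)
  next
    case False
    then have "int r - int (r - 1) = int 1" by simp
    then show ?thesis
      by (simp only: left_contr_def graded_prod_multivecs[OF PA[OF assms(2)] inv_r]
          mult_mult_inv_right[OF inv] grade_part_multivec[OF vec_multivecs[OF P_vec[OF assms(2)]]])
        simp
  qed
  moreover have "right_contr G0 G1 (?Q a * A) (mult_inv A) = ?Q a"
    by (simp only: right_contr_def graded_prod_multivecs[OF QA[OF assms(2)] inv_r]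
        mult_mult_inv_right[OF inv] grade_part_multivec[OF vec_multivecs[OF Q_vec[OF assms(2)]]]) simp
  ultimately show ?thesis
    by (simp only: left[OF assms(2)] outer[OF assms(2)] mult_mult_inv_right[OF inv])
qed

end
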